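(* Let $a_n=3n-\lfloor n/2\rfloor-2$, $b_n=3n-\lfloor n/2\rfloor-1$, $c_n=5n-5$ ($n\ge 1$) be the elements of rank $n$ of the three sets of the standard partition. The following are infinitely many ways (one for each indicated $k$ in i) and in ii)) to obtain partitions equivalent to the standard partition by starting with the standard partition and reshuffling elements such that the pattern of the sums is preserved: i) For $k\ge 1$: interchange the pair of elements of rank $4k$ in the first and last set, $\{a_{4k},c_{4k}\}$, with the pair of elements of rank $6k-1$ in the first two sets, $\{a_{6k-1},b_{6k-1}\}$ (each pair being placed, in either order, in the two positions vacated by the other pair). ii) For $k\ge 0$: interchange the pair of elements of rank $4k+3$ in the last two sets, $\{b_{4k+3},c_{4k+3}\}$, with the pair of elements of rank $6k+4$ in the first two sets, $\{a_{6k+4},b_{6k+4}\}$ (each pair being placed, in either order, in the two positions vacated by the other pair). That is, for each such $k$, the resulting three enumerated sets form a partition of the non-negative integers which is equivalent to the standard partition, and for every $n\ge1$ the sum of its three elements of rank $n$ is $11n-2\lfloor n/2\rfloor-8$.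
   Context: A partition of the non-negative integers into three sets $A,B,C$ is considered together with enumerations without repetition $A=\{a_k\mid k\ge 1\}$, $B=\{b_k\mid k\ge 1\}$, $C=\{c_k\mid k\ge 1\}$ (not required to be increasing): every non-negative integer occurs exactly once among the $a_k,b_k,c_k$. The elements $a_k,b_k,c_k$ are the elements of rank $k$. The standard partition of the non-negative integers is given by the three sets (first, second, last), enumerated by $n\ge 1$, $$S_1=\{3n-\lfloor n/2\rfloor-2\mid n\ge 1\},\quad S_2=\{3n-\lfloor n/2\rfloor-1\mid n\ge 1\},\quad S_3=\{5n-5\mid n\ge 1\}.$$ The sum of its elements of rank $n$ is $S(n)=11n-2\lfloor n/2\rfloor-8$; "the pattern of the sums is preserved" means that the sum of the elements of rank $n$ is still $S(n)$ for every $n\ge 1$. Two partitions $A=\{a_k\},B=\{b_k\},C=\{c_k\}$ and $D=\{d_k\},E=\{e_k\},F=\{f_k\}$ ($k\ge 1$) of the non-negative integers are equivalent if there exists a number $N$ such that $a_k=d_k$, $b_k=e_k$ and $c_k=f_k$ for all $k>N$. *)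

theory Defs
  imports Main
begin

datatype slot = First | Second | Last

text \<open>
  Three enumerated sets \<open>A = {a\<^sub>k}\<close>, \<open>B = {b\<^sub>k}\<close>, \<open>C = {c\<^sub>k}\<close> are encoded as one function on
  positions: \<open>P (First, k) = a\<^sub>k\<close>, \<open>P (Second, k) = b\<^sub>k\<close>, \<open>P (Last, k) = c\<^sub>k\<close>.
  Ranks start at 1, so the values at rank 0 carry no meaning.
\<close>

type_synonym position = "slot \<times> nat"
type_synonym arrangement = "position \<Rightarrow> nat"

definition positions :: "position set" where
  "positions = UNIV \<times> {1..}"

text \<open>Every non-negative integer occurs exactly once, at exactly one position.\<close>

definition is_partition :: "arrangement \<Rightarrow> bool" where
  "is_partition P \<longleftrightarrow> bij_betw P positions UNIV"

definition equivalent :: "arrangement \<Rightarrow> arrangement \<Rightarrow> bool" where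
  "equivalent P Q \<longleftrightarrow> is_partition P \<and> is_partition Q \<and>
     (\<exists>N. \<forall>k>N. \<forall>s. P (s, k) = Q (s, k))"

text \<open>For ranks \<open>n \<ge> 1\<close> no subtraction below truncates.\<close>

fun standard :: arrangement where
  "standard (First, n) = 3 * n - n div 2 - 2"
| "standard (Second, n) = 3 * n - n div 2 - 1"
| "standard (Last, n) = 5 * n - 5"

definition preserves_sums :: "arrangement \<Rightarrow> bool" where
  "preserves_sums P \<longleftrightarrow>
     (\<forall>n\<ge>1. P (First, n) + P (Second, n) + P (Last, n) = 11 * n - 2 * (n div 2) - 8)"

text \<open>
  The results of interchanging the pair of elements at the positions \<open>p1\<close>, \<open>p2\<close> with the pair at
  \<open>q1\<close>, \<open>q2\<close>, everything else staying in place. Each pair may be placed in either order in the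
  two vacated positions, so there are four results when the four elements and the four positions
  are distinct.
\<close>

definition interchanges ::
  "arrangement \<Rightarrow> position \<times> position \<Rightarrow> position \<times> position \<Rightarrow> arrangement set" where
  "interchanges P = (\<lambda>(p1, p2) (q1, q2).
     {P(p1 := x, p2 := y, q1 := u, q2 := v) | x y u v.
        (x, y) \<in> {(P q1, P q2), (P q2, P q1)} \<and>
        (u, v) \<in> {(P p1, P p2), (P p2, P p1)}})"

definition ways_i :: "nat \<Rightarrow> arrangement set" where
  "ways_i k = interchanges standard
     ((First, 4 * k), (Last, 4 * k))
     ((First, 6 * k - 1), (Second, 6 * k - 1))"

definition ways_ii :: "nat \<Rightarrow> arrangement set" where
  "ways_ii k = interchanges standard
     ((Second, 4 * k + 3), (Last, 4 * k + 3))
     ((First, 6 * k + 4), (Second, 6 * k + 4))"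

end

theory Submission
  imports Defs
begin

text \<open>
  An interchange of two pairs permutes the values at finitely many positions, so it keeps the
  partition property and the equivalence class. It keeps the sums as soon as each pair lies within
  one rank and both pairs have the same sum: \<open>30k - 7\<close> in case i), \<open>30k + 17\<close> in case ii).
  The standard enumeration is a partition by residues modulo 5: ranks \<open>2m + 1\<close> and \<open>2m\<close> of the
  first two sets give the residues 1, 2 and 3, 4, and the last set gives the residue 0.
\<close>

lemma is_partition_standard: "is_partition standard"
proof -
  \<comment> \<open>The inverse of \<open>standard\<close>: the residue of \<open>v\<close> modulo 5
    picks the set and the parity of the rank. The even rank with quotient \<open>m\<close> is
    \<open>2 * m + 2\<close>, since its first two elements are \<open>5 * m + 3\<close> and
    \<open>5 * m + 4\<close>.\<close>
  define rank_of :: "nat \<Rightarrow> position" where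
    "rank_of v = (let m = v div 5 in
       if v mod 5 = 0 then (Last, m + 1)
       else if v mod 5 = 1 then (First, 2 * m + 1)
       else if v mod 5 = 2 then (Second, 2 * m + 1)
       else if v mod 5 = 3 then (First, 2 * m + 2)
       else (Second, 2 * m + 2))" for v
  have left: "rank_of (standard (s, n)) = (s, n)" if "n \<ge> 1" for s n
  proof -
    have first_or_second:
      "rank_of (standard (First, n)) = (First, n) \<and> rank_of (standard (Second, n)) = (Second, n)"
    proof (cases "even n")
      case True
      then obtain m where "n = 2 * m" ..
      \<comment> \<open>The shift, possible as \<open>n\<close> is not 0, makes \<open>j\<close> the
        quotient by 5 of both elements.\<close>
      with that obtain j where "n = 2 * j + 2"
        by (cases m) auto
      then have "standard (First, n) = 3 + 5 * j" "standard (Second, n) = 4 + 5 * j"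
        by simp_all
      with \<open>n = 2 * j + 2\<close> show ?thesis
        by (simp add: rank_of_def Let_def del: standard.simps)
    next
      case False
      then obtain j where "n = 2 * j + 1" ..
      then have "standard (First, n) = 1 + 5 * j" "standard (Second, n) = 2 + 5 * j"
        by simp_all
      moreover have "(2 + 5 * j) mod 5 = 2" "(2 + 5 * j) div 5 = j"
        "(1 + 5 * j) mod 5 = 1" "(1 + 5 * j) div 5 = j"
        by presburger+
      ultimately show ?thesis
        using \<open>n = 2 * j + 1\<close> by (simp add: rank_of_def Let_def del: standard.simps)
    qed
    have "standard (Last, n) = 5 * (n - 1)"
      by simp
    then have "rank_of (standard (Last, n)) = (Last, n)"
      using that by (simp add: rank_of_def Let_def del: standard.simps)
    with first_or_second show ?thesis
      by (cases s) blast+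
  qed
  have right: "standard (rank_of v) = v" for v
    by (auto simp: rank_of_def Let_def; presburger)
  show ?thesis
    unfolding is_partition_def
  proof (rule bij_betw_byWitness)
    show "\<forall>p\<in>positions. rank_of (standard p) = p"
      by (auto simp: left positions_def)
    show "\<forall>v\<in>UNIV. standard (rank_of v) = v"
      by (simp add: right)
    show "rank_of ` UNIV \<subseteq> positions"
      by (rule image_subsetI) (simp add: rank_of_def Let_def positions_def)
  qed simp
qed

lemma preserves_sums_standard: "preserves_sums standard"
  by (auto simp: preserves_sums_def)

text \<open>Counting makes \<open>P\<close> injective on \<open>F\<close>: its image there has as
  many elements as the finite set \<open>F\<close>. Off \<open>F\<close> it is \<open>Q\<close>, and
  injectivity of \<open>Q\<close> keeps the two images disjoint.\<close>

lemma is_partition_permute_finite: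
  assumes Q: "is_partition Q"
    and F: "finite F" "F \<subseteq> positions"
    and image: "P ` F = Q ` F"
    and agree: "\<And>p. p \<notin> F \<Longrightarrow> P p = Q p"
  shows "is_partition P"
proof -
  have inj: "inj_on Q positions" and surj: "Q ` positions = UNIV"
    using Q by (auto simp: is_partition_def bij_betw_def)
  have "inj_on Q F"
    using inj F(2) by (rule inj_on_subset)
  then have "card (P ` F) = card F"
    by (simp add: image card_image)
  then have "bij_betw P F (Q ` F)"
    using F(1) image by (simp add: bij_betw_def eq_card_imp_inj_on)
  moreover have "bij_betw P (positions - F) (Q ` (positions - F))"
  proof -
    have "bij_betw Q (positions - F) (Q ` (positions - F))"
      using inj by (auto intro: inj_on_imp_bij_betw inj_on_subset)
    then show ?thesis
      using agree by (subst bij_betw_cong[where g = Q]) auto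
  qed
  moreover have "Q ` F \<inter> Q ` (positions - F) = {}"
    using inj F(2) by (auto dest: inj_onD)
  ultimately have "bij_betw P (F \<union> (positions - F)) (Q ` F \<union> Q ` (positions - F))"
    by (rule bij_betw_combine)
  moreover have "F \<union> (positions - F) = positions"
    using F(2) by blast
  moreover from this have "Q ` F \<union> Q ` (positions - F) = UNIV"
    using surj by (metis image_Un)
  ultimately show ?thesis
    by (simp add: is_partition_def)
qed

text \<open>At distinct positions no update overwrites another, so the four values are merely
  permuted.\<close>

lemma is_partition_interchanges:
  assumes P: "P \<in> interchanges Q (p1, p2) (q1, q2)"
    and Q: "is_partition Q"
    and dist: "distinct [p1, p2, q1, q2]"
    and pos: "{p1, p2, q1, q2} \<subseteq> positions"
  shows "is_partition P"
  using Q _ pos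
proof (rule is_partition_permute_finite)
  show "P ` {p1, p2, q1, q2} = Q ` {p1, p2, q1, q2}"
    using P dist by (auto simp: interchanges_def)
  show "P p = Q p" if "p \<notin> {p1, p2, q1, q2}" for p
    using P that by (auto simp: interchanges_def)
qed simp

lemma equivalent_interchanges:
  assumes P: "P \<in> interchanges Q (p1, p2) (q1, q2)"
    and Q: "is_partition Q"
    and dist: "distinct [p1, p2, q1, q2]"
    and pos: "{p1, p2, q1, q2} \<subseteq> positions"
  shows "equivalent P Q"
proof -
  define N where "N = Max (snd ` {p1, p2, q1, q2})"
  have "P (s, k) = Q (s, k)" if "k > N" for s k
  proof -
    have "snd p \<le> N" if "p \<in> {p1, p2, q1, q2}" for p
      unfolding N_def using that by (intro Max_ge) auto
    with \<open>k > N\<close> have "(s, k) \<notin> {p1, p2, q1, q2}"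
      by fastforce
    then show ?thesis
      using P by (auto simp: interchanges_def)
  qed
  then show ?thesis
    using is_partition_interchanges[OF assms] Q by (auto simp: equivalent_def)
qed

lemma preserves_sums_interchanges:
  assumes P: "P \<in> interchanges Q ((s1, m), (s2, m)) ((t1, n), (t2, n))"
    and Q: "preserves_sums Q"
    and "s1 \<noteq> s2" "t1 \<noteq> t2" "m \<noteq> n"
    and sum: "Q (s1, m) + Q (s2, m) = Q (t1, n) + Q (t2, n)"
  shows "preserves_sums P"
proof -
  have "P (First, j) + P (Second, j) + P (Last, j) = Q (First, j) + Q (Second, j) + Q (Last, j)"
    for j
  proof -
    have m: "P (s1, m) + P (s2, m) = Q (s1, m) + Q (s2, m)"
      and n: "P (t1, n) + P (t2, n) = Q (t1, n) + Q (t2, n)"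
      using P assms(3-) by (auto simp: interchanges_def)
    have rest: "P p = Q p" if "p \<notin> {(s1, m), (s2, m), (t1, n), (t2, n)}" for p
      using P that by (auto simp: interchanges_def)
    consider "j = m" | "j = n" | "j \<noteq> m" "j \<noteq> n"
      by blast
    then show ?thesis
    proof cases
      case 1
      \<comment> \<open>The two slots of the pair keep their joint sum by \<open>m\<close>; of the
        instances of \<open>rest\<close>, the one for the third slot of this rank applies.\<close>
      then show ?thesis
        using m rest[of "(First, m)"] rest[of "(Second, m)"] rest[of "(Last, m)"] assms(3,5)
        by (cases s1; cases s2) auto
    next
      case 2
      then show ?thesis
        using n rest[of "(First, n)"] rest[of "(Second, n)"] rest[of "(Last, n)"] assms(4,5)
        by (cases t1; cases t2) auto
    next
      case 3
      then show ?thesis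
        by (simp add: rest)
    qed
  qed
  then show ?thesis
    using Q by (simp add: preserves_sums_def)
qed

text \<open>The position \<open>p2 k\<close> is touched by the \<open>k\<close>-th interchange and by no other.\<close>

lemma infinite_interchanges:
  assumes K: "infinite K"
    and inj: "inj_on p2 K"
    and fresh: "\<And>k l. k \<in> K \<Longrightarrow> l \<in> K \<Longrightarrow> p2 k \<notin> {p1 l, q1 l, q2 l}"
    and moved: "\<And>k. k \<in> K \<Longrightarrow> Q (q2 k) \<noteq> Q (p2 k)"
  shows "infinite (\<Union>k\<in>K. interchanges Q (p1 k, p2 k) (q1 k, q2 k))"
proof -
  \<comment> \<open>One of the possible orders for each \<open>k\<close> suffices, provided that
    different \<open>k\<close> give different arrangements.\<close>
  define W where
    "W k = Q(p1 k := Q (q1 k), p2 k := Q (q2 k), q1 k := Q (p1 k), q2 k := Q (p2 k))" for k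
  have "inj_on W K"
  proof (rule inj_onI, rule ccontr)
    fix k l assume kl: "k \<in> K" "l \<in> K" "W k = W l" "k \<noteq> l"
    \<comment> \<open>The position \<open>p2 k\<close> separates the two: \<open>W k\<close> puts a
      new value there, while \<open>W l\<close> leaves the value of \<open>Q\<close>.\<close>
    have "p2 k \<noteq> p2 l"
      using inj kl(1,2,4) by (auto dest: inj_onD)
    have "W k (p2 k) = Q (q2 k)"
      using fresh[OF kl(1,1)] by (simp add: W_def)
    moreover have "W l (p2 k) = Q (p2 k)"
      using fresh[OF kl(1,2)] \<open>p2 k \<noteq> p2 l\<close> by (simp add: W_def)
    ultimately show False
      using moved[OF kl(1)] kl(3) by simp
  qed
  then have "infinite (W ` K)"
    using K by (simp add: finite_image_iff)
  moreover have "W ` K \<subseteq> (\<Union>k\<in>K. interchanges Q (p1 k, p2 k) (q1 k, q2 k))"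
  proof (rule image_subsetI)
    fix k assume "k \<in> K"
    moreover have "W k \<in> interchanges Q (p1 k, p2 k) (q1 k, q2 k)"
      by (auto simp: interchanges_def W_def)
    ultimately show "W k \<in> (\<Union>k\<in>K. interchanges Q (p1 k, p2 k) (q1 k, q2 k))"
      by (rule UN_I)
  qed
  ultimately show ?thesis
    using finite_subset by blast
qed

text \<open>The floors at the two odd ranks; \<open>Suc 0\<close> is the form in which the
  simplifier leaves the 1.\<close>

lemma div_two_rank: "(6 * k - Suc 0) div 2 = 3 * k - 1" "(4 * k + 3) div 2 = 2 * k + 1" for k :: nat
  by presburger+

theorem proposition2p2:
  "(\<forall>k\<ge>1. \<forall>P\<in>ways_i k. is_partition P \<and> equivalent P standard \<and> preserves_sums P) \<and>
   (\<forall>k. \<forall>P\<in>ways_ii k. is_partition P \<and> equivalent P standard \<and> preserves_sums P) \<and>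
   infinite (\<Union>k\<in>{1..}. ways_i k) \<and>
   infinite (\<Union>k. ways_ii k)"
proof (intro conjI)
  show "\<forall>k\<ge>1. \<forall>P\<in>ways_i k. is_partition P \<and> equivalent P standard \<and> preserves_sums P"
  proof (intro allI impI ballI)
    fix k P assume k: "k \<ge> (1::nat)" and P: "P \<in> ways_i k"
    \<comment> \<open>The ranks differ in parity; at \<open>k = 0\<close> truncation would make both
      0.\<close>
    have ranks: "4 * k \<noteq> 6 * k - 1"
      using k by presburger
    have sums: "standard (First, 4 * k) + standard (Last, 4 * k)
        = standard (First, 6 * k - 1) + standard (Second, 6 * k - 1)"
      using k by (simp add: div_two_rank)
    have "preserves_sums P"
      by (rule preserves_sums_interchanges
          [OF P[unfolded ways_i_def] preserves_sums_standard _ _ ranks sums]) simp_all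
    moreover have "equivalent P standard"
      using P is_partition_standard unfolding ways_i_def
      by (rule equivalent_interchanges) (use k ranks in \<open>auto simp: positions_def\<close>)
    ultimately show "is_partition P \<and> equivalent P standard \<and> preserves_sums P"
      by (simp add: equivalent_def)
  qed
  show "\<forall>k. \<forall>P\<in>ways_ii k. is_partition P \<and> equivalent P standard \<and> preserves_sums P"
  proof (intro allI ballI)
    fix k P assume P: "P \<in> ways_ii k"
    have ranks: "4 * k + 3 \<noteq> 6 * k + 4"
      by presburger
    \<comment> \<open>The elements are \<open>10 * k + 7\<close> and \<open>20 * k + 10\<close>
      against \<open>15 * k + 8\<close> and \<open>15 * k + 9\<close>.\<close>
    have sums: "standard (Second, 4 * k + 3) + standard (Last, 4 * k + 3)
        = standard (First, 6 * k + 4) + standard (Second, 6 * k + 4)"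
      by (simp add: div_two_rank)
    have "preserves_sums P"
      by (rule preserves_sums_interchanges
          [OF P[unfolded ways_ii_def] preserves_sums_standard _ _ ranks sums]) simp_all
    moreover have "equivalent P standard"
      using P is_partition_standard unfolding ways_ii_def
      by (rule equivalent_interchanges) (auto simp: positions_def)
    ultimately show "is_partition P \<and> equivalent P standard \<and> preserves_sums P"
      by (simp add: equivalent_def)
  qed
  \<comment> \<open>The position in the last set serves as \<open>p2\<close>: the other three lie in
    the first two sets, so none can meet it. Its value is a multiple of 5, unlike the incoming
    \<open>15 * k - 3\<close>.\<close>
  show "infinite (\<Union>k\<in>{1..}. ways_i k)"
    unfolding ways_i_def
  proof (rule infinite_interchanges[where Q = standard
      and ?p1.0 = "\<lambda>k. (First, 4 * k)" and ?p2.0 = "\<lambda>k. (Last, 4 * k)"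
      and ?q1.0 = "\<lambda>k. (First, 6 * k - 1)" and ?q2.0 = "\<lambda>k. (Second, 6 * k - 1)"])
    show "standard (Second, 6 * k - 1) \<noteq> standard (Last, 4 * k)" if "k \<in> {1..}" for k
      using that by (simp add: div_two_rank)
  qed (auto simp: infinite_Ici inj_on_def)
  show "infinite (\<Union>k. ways_ii k)"
    unfolding ways_ii_def
  proof (rule infinite_interchanges[where Q = standard
      and ?p1.0 = "\<lambda>k. (Second, 4 * k + 3)" and ?p2.0 = "\<lambda>k. (Last, 4 * k + 3)"
      and ?q1.0 = "\<lambda>k. (First, 6 * k + 4)" and ?q2.0 = "\<lambda>k. (Second, 6 * k + 4)"])
    \<comment> \<open>Again a multiple of 5 is replaced by a non-multiple, here
      \<open>15 * k + 9\<close>.\<close>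
    show "standard (Second, 6 * k + 4) \<noteq> standard (Last, 4 * k + 3)" for k
      by simp
  qed (auto simp: inj_on_def)
qed

end
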